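(* Let $(w_k),(w'_k),(y_k),(x_k)$ be sequences generated by the IneIREG-Bregman algorithm (described in the context), with parameters $\alpha_k\ge 0$, $\lambda_k>0$, $\eta_k>0$, and let $\delta_k:=\frac{\alpha_k(1+\alpha_k)}{2\mu}\|\nabla\omega(x_k)-\nabla\omega(x_{k-1})\|^2$ for $k\ge 0$. Suppose that: (i) $\eta_k=\eta$ for all $k\ge0$, where $\eta>0$ is a constant; (ii) $\alpha_0\in[0,1]$ and $\alpha_k\eta_k^{-1}\ge\alpha_{k+1}\eta_{k+1}^{-1}$ for all $k\ge0$ (that is, $(\alpha_k)$ is nonincreasing); (iii) $\lambda_k\in[\underline\lambda,\overline\lambda]$ for all $k\ge0$, where $0<\underline\lambda\le\overline\lambda\le\mu/L_0$ and $L_0:=L_F+\eta L_H$; (iv) $\widehat s:=\sum_{k=0}^\infty\delta_k<+\infty$. For $k\ge1$ let $\overline y_k:=\frac1{\Lambda_k}\sum_{j=0}^{k-1}\lambda_jy_j$ with $\Lambda_k:=\sum_{j=0}^{k-1}\lambda_j$. Then the following hold. (a) (Feasibility) For all $k\ge1$, $$0\le\operatorname{Gap}(\overline y_k,F,X)\le\frac1k\left(\frac{\Omega_X^2+\widehat s}{\underline\lambda}\right)+\eta\left(\frac{\overline\lambda C_HD_X}{\underline\lambda}\right).$$ (b) (Optimality) For all $k\ge1$, $$-B_H\operatorname{dist}(\overline y_k,Q)\le\operatorname{Gap}(\overline y_k,H,Q)\le\frac1k\left(\frac{\Omega_X^2+\widehat s}{\underline\lambda\,\eta}\right).$$ Moreover,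 if $Q$ is $\sigma$-weakly sharp of order $\mathcal M\ge1$, then for all $k\ge1$, $$\operatorname{Gap}(\overline y_k,H,Q)\ge-\frac{B_H}{\sigma^{1/\mathcal M}}\left(\frac1k\left(\frac{\Omega_X^2+\widehat s}{\underline\lambda}\right)+\eta\left(\frac{\overline\lambda C_HD_X}{\underline\lambda}\right)\right)^{1/\mathcal M}.$$
   Context: $\mathbb R^n$ carries its Euclidean inner product $\langle\cdot,\cdot\rangle$ and norm $\|\cdot\|$. Distance-generating function: $\omega:\mathbb R^n\to\mathbb R\cup\{+\infty\}$ is $\mu$-strongly convex ($\mu>0$) with respect to $\|\cdot\|$ and of Legendre type, i.e. proper, closed, strictly convex and essentially smooth (differentiable on $\operatorname{int}(\operatorname{dom}\omega)\ne\emptyset$, with $\|\nabla\omega(x^k)\|\to+\infty$ whenever $(x^k)\subset\operatorname{int}(\operatorname{dom}\omega)$ converges to a boundary point of $\operatorname{dom}\omega$). $\omega^*$ is its convex conjugate. The Bregman distance is $D_\omega(x,y):=\omega(x)-\omega(y)-\langle\nabla\omega(y),x-y\rangle$ for $x\in\operatorname{dom}\omega$, $y\in\operatorname{int}(\operatorname{dom}\omega)$. Problem data: $F:\operatorname{dom}F\subseteq\mathbb R^n\to\mathbb R^n$ and $H:\operatorname{dom}H\subseteq\mathbb R^n\to\mathbb R^n$ are monotone and Lipschitz continuous with constants $L_F>0$ and $L_H>0$. $X$ and $\Omega$ are nonempty closed convex subsets of $\mathbb R^n$ with $X\subset\Omega\subseteq\operatorname{dom}\omega\subseteq\operatorname{dom}F\cap\operatorname{dom}H$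 (inclusions not necessarily strict). $Q:=\{x\in X:\langle F(x),y-x\rangle\ge0\ \ \forall y\in X\}$ is nonempty. Put $C_H:=\sup_{x\in X}\|H(x)\|<+\infty$ and $B_H:=\sup_{x\in Q}\|H(x)\|<+\infty$. Diameters: $D_X:=\sup_{u,v\in X}\|u-v\|$ and $\Omega_X^2:=\sup\{D_\omega(u,v):u\in X,\ v\in X\cap\operatorname{int}(\operatorname{dom}\omega)\}$, both assumed finite. Dual gap functions: $\operatorname{Gap}(z,H,Q):=\sup_{x\in Q}\langle H(x),z-x\rangle$ and $\operatorname{Gap}(z,F,X):=\sup_{x\in X}\langle F(x),z-x\rangle$. Also $\operatorname{dist}(z,Q):=\inf_{q\in Q}\|z-q\|$. $Q$ is $\sigma$-weakly sharp of order $\mathcal M\ge1$ if $\sigma>0$ and $\langle F(x),y-x\rangle\ge\sigma\,(\operatorname{dist}(y,Q))^{\mathcal M}$ for all $x\in Q$, $y\in X$. IneIREG-Bregman algorithm: start with $x_0=x_{-1}\in X\cap\operatorname{int}(\operatorname{dom}\omega)$. For $k=0,1,\dots$, with chosen $\alpha_k\ge0$, $\lambda_k>0$, $\eta_k>0$, set $w_k:=\nabla\omega^*\big((1+\alpha_k)\nabla\omega(x_k)-\alpha_k\nabla\omega(x_{k-1})\big)$, $w'_k:=\operatorname{argmin}_{u\in\Omega}D_\omega(u,w_k)$, $y_k:=\operatorname{argmin}_{u\in X}\{\lambda_k\langle F(w'_k)+\eta_kH(w'_k),u\rangle+D_\omega(u,w_k)\}$, $x_{k+1}:=\operatorname{argmin}_{u\in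 X}\{\lambda_k\langle F(y_k)+\eta_kH(y_k),u\rangle+D_\omega(u,w_k)\}$. (These are well defined, all points lying in $\operatorname{int}(\operatorname{dom}\omega)$.) *)

theory Defs
  imports "HOL-Analysis.Analysis"
begin

definition edom :: "('a \<Rightarrow> ereal) \<Rightarrow> 'a set" where
  "edom f = {x. f x < \<infinity>}"

definition proper_fun :: "('a \<Rightarrow> ereal) \<Rightarrow> bool" where
  "proper_fun f \<longleftrightarrow> (\<forall>x. f x \<noteq> -\<infinity>) \<and> edom f \<noteq> {}"

definition closed_fun :: "('a::euclidean_space \<Rightarrow> ereal) \<Rightarrow> bool" where
  "closed_fun f \<longleftrightarrow> closed {(x, r::real). f x \<le> ereal r}"

definition strictly_convex_fun :: "('a::euclidean_space \<Rightarrow> ereal) \<Rightarrow> bool" where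
  "strictly_convex_fun f \<longleftrightarrow>
     (\<forall>x\<in>edom f. \<forall>y\<in>edom f. \<forall>t::real. x \<noteq> y \<and> 0 < t \<and> t < 1 \<longrightarrow>
        f ((1 - t) *\<^sub>R x + t *\<^sub>R y) < ereal (1 - t) * f x + ereal t * f y)"

definition strongly_convex_fun :: "real \<Rightarrow> ('a::euclidean_space \<Rightarrow> ereal) \<Rightarrow> bool" where
  "strongly_convex_fun \<mu> f \<longleftrightarrow>
     (\<forall>x y. \<forall>t\<in>{0..1}.
        f ((1 - t) *\<^sub>R x + t *\<^sub>R y) + ereal (\<mu> / 2 * t * (1 - t) * (norm (x - y))\<^sup>2)
          \<le> ereal (1 - t) * f x + ereal t * f y)"

text \<open>The gradient is taken of the real-valued part of \<open>f\<close>. For proper \<open>f\<close> the two agree near every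
  point of the interior of \<open>edom f\<close>, and the gradient is only meaningful at such points.\<close>

definition egrad :: "('a::euclidean_space \<Rightarrow> ereal) \<Rightarrow> 'a \<Rightarrow> 'a" where
  "egrad f x = (THE g. GDERIV (\<lambda>u. real_of_ereal (f u)) x :> g)"

definition essentially_smooth :: "('a::euclidean_space \<Rightarrow> ereal) \<Rightarrow> bool" where
  "essentially_smooth f \<longleftrightarrow>
     interior (edom f) \<noteq> {} \<and>
     (\<forall>x\<in>interior (edom f). (\<lambda>u. real_of_ereal (f u)) differentiable (at x)) \<and>
     (\<forall>s x. (\<forall>k. s k \<in> interior (edom f)) \<and> s \<longlonglongrightarrow> x \<and> x \<in> frontier (edom f) \<longrightarrow>
        filterlim (\<lambda>k. norm (egrad f (s k))) at_top sequentially)"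

definition legendre_fun :: "('a::euclidean_space \<Rightarrow> ereal) \<Rightarrow> bool" where
  "legendre_fun f \<longleftrightarrow>
     proper_fun f \<and> closed_fun f \<and> strictly_convex_fun f \<and> essentially_smooth f"

definition conjugate_fun :: "('a::euclidean_space \<Rightarrow> ereal) \<Rightarrow> 'a \<Rightarrow> ereal" where
  "conjugate_fun f p = (SUP x. ereal (x \<bullet> p) - f x)"

text \<open>Meaningful for \<open>x\<close> in the domain of \<open>\<omega>\<close> and \<open>y\<close> in its interior.\<close>

definition bregman :: "('a::euclidean_space \<Rightarrow> ereal) \<Rightarrow> 'a \<Rightarrow> 'a \<Rightarrow> real" where
  "bregman \<omega> x y = real_of_ereal (\<omega> x) - real_of_ereal (\<omega> y) - egrad \<omega> y \<bullet> (x - y)"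

definition bregman_vals :: "('a::euclidean_space \<Rightarrow> ereal) \<Rightarrow> 'a set \<Rightarrow> real set" where
  "bregman_vals \<omega> X = {bregman \<omega> u v | u v. u \<in> X \<and> v \<in> X \<inter> interior (edom \<omega>)}"

text \<open>This supremum is the quantity written as a square, \<open>\<Omega>\<^sub>X\<^sup>2\<close>, in the literature.\<close>

definition bregman_diam_sq :: "('a::euclidean_space \<Rightarrow> ereal) \<Rightarrow> 'a set \<Rightarrow> real" where
  "bregman_diam_sq \<omega> X = Sup (bregman_vals \<omega> X)"

definition monotone_operator_on :: "'a::euclidean_space set \<Rightarrow> ('a \<Rightarrow> 'a) \<Rightarrow> bool" where
  "monotone_operator_on S G \<longleftrightarrow> (\<forall>x\<in>S. \<forall>y\<in>S. (G x - G y) \<bullet> (x - y) \<ge> 0)"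

definition VI_solutions :: "('a::euclidean_space \<Rightarrow> 'a) \<Rightarrow> 'a set \<Rightarrow> 'a set" where
  "VI_solutions F X = {x \<in> X. \<forall>y\<in>X. F x \<bullet> (y - x) \<ge> 0}"

definition sup_norm_on :: "('a::euclidean_space \<Rightarrow> 'a) \<Rightarrow> 'a set \<Rightarrow> real" where
  "sup_norm_on G S = (SUP x\<in>S. norm (G x))"

definition gap :: "'a::euclidean_space \<Rightarrow> ('a \<Rightarrow> 'a) \<Rightarrow> 'a set \<Rightarrow> ereal" where
  "gap z G S = (SUP x\<in>S. ereal (G x \<bullet> (z - x)))"

definition weakly_sharp ::
  "real \<Rightarrow> real \<Rightarrow> ('a::euclidean_space \<Rightarrow> 'a) \<Rightarrow> 'a set \<Rightarrow> 'a set \<Rightarrow> bool" where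
  "weakly_sharp \<sigma> M F X Q \<longleftrightarrow>
     \<sigma> > 0 \<and> M \<ge> 1 \<and> (\<forall>x\<in>Q. \<forall>y\<in>X. F x \<bullet> (y - x) \<ge> \<sigma> * infdist y Q powr M)"

text \<open>\<open>prev x k\<close> is the iterate with index \<open>k - 1\<close>, under the convention that the one with index
  \<open>-1\<close> equals \<open>x 0\<close>.\<close>

definition prev :: "(nat \<Rightarrow> 'a) \<Rightarrow> nat \<Rightarrow> 'a" where
  "prev x k = (case k of 0 \<Rightarrow> x 0 | Suc j \<Rightarrow> x j)"

definition argmin_over :: "('a \<Rightarrow> real) \<Rightarrow> 'a set \<Rightarrow> 'a \<Rightarrow> bool" where
  "argmin_over f S u \<longleftrightarrow> is_arg_min f (\<lambda>v. v \<in> S) u"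

text \<open>The minimisers in the update steps are unique because \<open>\<omega>\<close> is strictly convex, so the
  relation below determines the sequences from \<open>x 0\<close>. That all iterates lie in the interior of the
  domain of \<open>\<omega>\<close> is a consequence of \<open>\<omega>\<close> being of Legendre type and is not imposed.\<close>

definition IneIREG_Bregman ::
  "('a::euclidean_space \<Rightarrow> ereal) \<Rightarrow> 'a set \<Rightarrow> 'a set \<Rightarrow> ('a \<Rightarrow> 'a) \<Rightarrow> ('a \<Rightarrow> 'a) \<Rightarrow>
   (nat \<Rightarrow> real) \<Rightarrow> (nat \<Rightarrow> real) \<Rightarrow> (nat \<Rightarrow> real) \<Rightarrow>
   (nat \<Rightarrow> 'a) \<Rightarrow> (nat \<Rightarrow> 'a) \<Rightarrow> (nat \<Rightarrow> 'a) \<Rightarrow> (nat \<Rightarrow> 'a) \<Rightarrow> bool" where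
  "IneIREG_Bregman \<omega> \<Omega> X F H \<alpha> l \<eta> x w w' y \<longleftrightarrow>
     x 0 \<in> X \<inter> interior (edom \<omega>) \<and>
     (\<forall>k. \<alpha> k \<ge> 0 \<and> l k > 0 \<and> \<eta> k > 0 \<and>
        w k = egrad (conjugate_fun \<omega>)
                ((1 + \<alpha> k) *\<^sub>R egrad \<omega> (x k) - \<alpha> k *\<^sub>R egrad \<omega> (prev x k)) \<and>
        argmin_over (\<lambda>u. bregman \<omega> u (w k)) \<Omega> (w' k) \<and>
        argmin_over (\<lambda>u. l k * ((F (w' k) + \<eta> k *\<^sub>R H (w' k)) \<bullet> u) + bregman \<omega> u (w k)) X (y k) \<and>
        argmin_over (\<lambda>u. l k * ((F (y k) + \<eta> k *\<^sub>R H (y k)) \<bullet> u) + bregman \<omega> u (w k)) X (x (Suc k)))"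

definition inertial_err ::
  "real \<Rightarrow> ('a::euclidean_space \<Rightarrow> ereal) \<Rightarrow> (nat \<Rightarrow> real) \<Rightarrow> (nat \<Rightarrow> 'a) \<Rightarrow> nat \<Rightarrow> real" where
  "inertial_err \<mu> \<omega> \<alpha> x k =
     \<alpha> k * (1 + \<alpha> k) / (2 * \<mu>) * (norm (egrad \<omega> (x k) - egrad \<omega> (prev x k)))\<^sup>2"

definition ergodic_avg :: "(nat \<Rightarrow> real) \<Rightarrow> (nat \<Rightarrow> 'a::euclidean_space) \<Rightarrow> nat \<Rightarrow> 'a" where
  "ergodic_avg l y k = (1 / (\<Sum>j<k. l j)) *\<^sub>R (\<Sum>j<k. l j *\<^sub>R y j)"

end

theory Submission
  imports Defs
begin

text \<open>
  Write \<open>D\<close> for the Bregman distance, \<open>\<nabla>\<close> for the gradient of \<open>\<omega>\<close> and \<open>G = F + \<eta> H\<close>, which is monotone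
  and Lipschitz with constant \<open>L\<^sub>F + \<eta> L\<^sub>H\<close>. The method is an extragradient method for \<open>G\<close>, and the
  heart of the proof is a one-step inequality: for every \<open>u\<close> in \<open>X\<close>,
  \<open>\<lambda>\<^sub>k \<langle>G y\<^sub>k, y\<^sub>k - u\<rangle> \<le> D(u, w\<^sub>k) - D(u, x\<^sub>k\<^sub>+\<^sub>1)\<close>.
  It comes from adding the optimality conditions of the two proximal steps. The error
  \<open>\<lambda>\<^sub>k \<langle>G y\<^sub>k - G w'\<^sub>k, y\<^sub>k - x\<^sub>k\<^sub>+\<^sub>1\<rangle>\<close> that remains is absorbed by \<open>D(x\<^sub>k\<^sub>+\<^sub>1, y\<^sub>k)\<close> and
  \<open>D(y\<^sub>k, w\<^sub>k)\<close>, because the step size is at most \<open>\<mu> / L\<close> and \<open>D\<close> dominates \<open>\<mu>/2\<close> times the squared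
  norm (\<open>extragradient_step\<close>).

  The inertial point \<open>w\<^sub>k\<close> is extrapolated in the dual space, where the conjugate of \<open>\<omega>\<close>
  is \<open>1/\<mu>\<close>-smooth, that is, \<open>D(a, b) \<le> \<parallel>\<nabla>a - \<nabla>b\<parallel>\<^sup>2 / (2\<mu>)\<close>. Hence \<open>D(u, w\<^sub>k)\<close> is at most
  \<open>D(u, x\<^sub>k) + \<alpha>\<^sub>k (D(u, x\<^sub>k) - D(u, x\<^sub>k\<^sub>-\<^sub>1)) + \<delta>\<^sub>k\<close> (\<open>inertial_step\<close>). As \<open>\<alpha>\<close> is nonincreasing and
  at most 1, summation by parts bounds the total by the Bregman diameter plus the sum of the \<open>\<delta>\<^sub>k\<close>
  (\<open>inertial_telescoping\<close>).

  Monotonicity replaces \<open>G y\<^sub>k\<close> by \<open>G u\<close>, and linearity moves the weighted sum inside, so that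
  \<open>\<langle>F u, z - u\<rangle> + \<eta> \<langle>H u, z - u\<rangle>\<close> is of order \<open>1/k\<close> at the ergodic average \<open>z\<close>. For the feasibility gap
  the \<open>H\<close> term is bounded by \<open>\<eta> C\<^sub>H D\<^sub>X\<close>; for the optimality gap the \<open>F\<close> term is nonnegative, since
  \<open>u\<close> solves the lower-level variational inequality. The lower bounds on the optimality gap are
  the Cauchy-Schwarz inequality at near-projections of \<open>z\<close> onto \<open>Q\<close>, combined, in the weakly sharp
  case, with the feasibility bound.

  What makes these computations legitimate is the Legendre property. Essential smoothness keeps
  every minimiser of a linearly tilted \<open>\<omega>\<close>, over a convex set that meets the interior of the
  domain, away from the boundary of the domain
  (\<open>minimiser_in_interior\<close>), so that all iterates have a gradient, and it makes the gradient of the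
  conjugate invert \<open>\<nabla>\<close> (\<open>conjugate_gradient_inverts\<close>).
\<close>

section \<open>Gradients and Bregman distances of strongly convex Legendre functions\<close>

lemma inner_sgn_self: "g \<bullet> sgn g = norm (g::'a::real_inner)"
  by (cases "g = 0") (simp_all add: sgn_div_norm dot_square_norm power2_eq_square)

lemma gderiv_unique:
  assumes "GDERIV f x :> a" "GDERIV f x :> (b::'a::euclidean_space)"
  shows "a = b"
proof -
  have "(\<lambda>h. h \<bullet> a) = (\<lambda>h. h \<bullet> b)"
    using assms has_derivative_unique unfolding gderiv_def by blast
  then have "\<forall>h. h \<bullet> a = h \<bullet> b" by (simp add: fun_eq_iff)
  then show ?thesis by (simp only: vector_eq_ldot)
qed

lemma egrad_eqI: "GDERIV (\<lambda>u. real_of_ereal (f u)) x :> g \<Longrightarrow> egrad f x = (g::'a::euclidean_space)"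
  unfolding egrad_def using gderiv_unique by blast

locale strongly_convex_legendre =
  fixes \<omega> :: "'a::euclidean_space \<Rightarrow> ereal" and \<mu> :: real
  assumes mu_pos: "\<mu> > 0"
    and strongly_convex: "strongly_convex_fun \<mu> \<omega>"
    and legendre: "legendre_fun \<omega>"
begin

abbreviation val :: "'a \<Rightarrow> real" where "val u \<equiv> real_of_ereal (\<omega> u)"
abbreviation dom :: "'a set" where "dom \<equiv> edom \<omega>"
abbreviation grad :: "'a \<Rightarrow> 'a" where "grad \<equiv> egrad \<omega>"
abbreviation breg :: "'a \<Rightarrow> 'a \<Rightarrow> real" where "breg \<equiv> bregman \<omega>"

lemma ereal_val: "u \<in> dom \<Longrightarrow> \<omega> u = ereal (val u)"
  using legendre by (cases "\<omega> u") (auto simp: legendre_fun_def proper_fun_def edom_def)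

lemma outside_dom: "u \<notin> dom \<Longrightarrow> \<omega> u = \<infinity>"
  by (simp add: edom_def)

lemma strong_convexity:
  assumes "u \<in> dom" "v \<in> dom" "0 \<le> t" "t \<le> 1"
  shows "(1 - t) *\<^sub>R u + t *\<^sub>R v \<in> dom"
    and "val ((1 - t) *\<^sub>R u + t *\<^sub>R v)
           \<le> (1 - t) * val u + t * val v - \<mu> / 2 * t * (1 - t) * (norm (u - v))\<^sup>2"
proof -
  let ?m = "(1 - t) *\<^sub>R u + t *\<^sub>R v"
  have ineq: "\<omega> ?m + ereal (\<mu> / 2 * t * (1 - t) * (norm (u - v))\<^sup>2)
      \<le> ereal (1 - t) * ereal (val u) + ereal t * ereal (val v)"
    using strongly_convex assms(3,4) ereal_val[OF assms(1), symmetric] ereal_val[OF assms(2), symmetric]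
    unfolding strongly_convex_fun_def by simp
  show m: "?m \<in> dom"
    using ineq by (cases "\<omega> ?m") (auto simp: edom_def)
  show "val ?m \<le> (1 - t) * val u + t * val v - \<mu> / 2 * t * (1 - t) * (norm (u - v))\<^sup>2"
    using ineq ereal_val[OF m] by (cases "\<omega> ?m") auto
qed

lemma convex_dom: "convex dom"
  unfolding convex_alt using strong_convexity(1) by blast

lemma interior_dom: "u \<in> interior dom \<Longrightarrow> u \<in> dom"
  using interior_subset by blast

lemma gderiv_grad:
  assumes "v \<in> interior dom"
  shows "GDERIV val v :> grad v"
proof -
  obtain f' where f': "(val has_derivative f') (at v)"
    using assms legendre unfolding legendre_fun_def essentially_smooth_def differentiable_def by blast
  have "f' = (\<lambda>h. h \<bullet> adjoint f' 1)"
    using adjoint_works[OF has_derivative_linear[OF f'], of _ 1] by auto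
  then have "GDERIV val v :> adjoint f' 1"
    using f' unfolding gderiv_def by simp
  then show ?thesis using egrad_eqI[of \<omega>] by simp
qed

lemma directional_limit:
  assumes "v \<in> interior dom"
  shows "((\<lambda>t. (val (v + t *\<^sub>R d) - val v) / t) \<longlongrightarrow> grad v \<bullet> d) (at_right 0)"
proof -
  have "((\<lambda>t::real. v + t *\<^sub>R d) has_derivative (\<lambda>t. t *\<^sub>R d)) (at 0)"
    by (auto intro!: derivative_eq_intros)
  moreover have "(val has_derivative (\<lambda>h. h \<bullet> grad v)) (at (v + 0 *\<^sub>R d))"
    using gderiv_grad[OF assms] by (simp add: gderiv_def)
  ultimately have "((\<lambda>t. val (v + t *\<^sub>R d)) has_derivative (\<lambda>t. (t *\<^sub>R d) \<bullet> grad v)) (at 0)"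
    using has_derivative_compose by blast
  then have "((\<lambda>t. val (v + t *\<^sub>R d)) has_real_derivative (grad v \<bullet> d)) (at 0)"
    unfolding has_field_derivative_def
    by (rule has_derivative_eq_rhs) (simp add: fun_eq_iff inner_commute)
  then show ?thesis
    by (simp add: DERIV_def filterlim_at_split)
qed

text \<open>Strong convexity along the segment from \<open>v\<close> to \<open>u\<close> bounds the difference quotient at \<open>v\<close>; the
  quadratic term survives in the limit with the factor \<open>1 - t\<close> tending to 1.\<close>

lemma breg_lower_bound:
  assumes u: "u \<in> dom" and v: "v \<in> interior dom"
  shows "\<mu> / 2 * (norm (u - v))\<^sup>2 \<le> breg u v"
proof -
  let ?n = "(norm (u - v))\<^sup>2"
  have "\<forall>\<^sub>F t in at_right 0. (val (v + t *\<^sub>R (u - v)) - val v) / t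
          \<le> val u - val v - \<mu> / 2 * (1 - t) * ?n"
  proof -
    have "(val (v + t *\<^sub>R (u - v)) - val v) / t \<le> val u - val v - \<mu> / 2 * (1 - t) * ?n"
      if "0 < t" "t < 1" for t
    proof -
      have "(1 - t) *\<^sub>R v + t *\<^sub>R u = v + t *\<^sub>R (u - v)"
        by (simp add: algebra_simps)
      then have "val (v + t *\<^sub>R (u - v)) - val v
          \<le> (val u - val v - \<mu> / 2 * (1 - t) * ?n) * t"
        using strong_convexity(2)[OF interior_dom[OF v] u, of t] that
        by (simp add: algebra_simps norm_minus_commute)
      then show ?thesis using that by (simp add: pos_divide_le_eq)
    qed
    then show ?thesis
      by (auto simp: eventually_at_right[of 0 "1::real"] intro!: exI[of _ 1])
  qed
  moreover have "((\<lambda>t. val u - val v - \<mu> / 2 * (1 - t) * ?n) \<longlongrightarrow> val u - val v - \<mu> / 2 * (1 - 0) * ?n)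
      (at_right 0)"
    by (intro tendsto_intros)
  ultimately have "grad v \<bullet> (u - v) \<le> val u - val v - \<mu> / 2 * (1 - 0) * ?n"
    using tendsto_le[OF _ _ directional_limit[OF v]] by (simp add: trivial_limit_at_right_real)
  then show ?thesis by (simp add: bregman_def)
qed

lemma breg_nonneg: "u \<in> dom \<Longrightarrow> v \<in> interior dom \<Longrightarrow> 0 \<le> breg u v"
  using breg_lower_bound[of u v] mu_pos by (smt (verit) zero_le_mult_iff zero_le_power2 half_gt_zero)

lemma three_points: "breg u a + breg a b - breg u b = (grad a - grad b) \<bullet> (a - u)"
  by (simp add: bregman_def algebra_simps inner_diff_left inner_diff_right)

text \<open>This is the \<open>1/\<mu>\<close>-smoothness of the conjugate, in primal form: the two distances between \<open>a\<close>
  and \<open>b\<close> add up to an inner product, and the lower bound for one of them bounds the other.\<close>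

lemma breg_upper_bound:
  assumes a: "a \<in> interior dom" and b: "b \<in> interior dom"
  shows "breg a b \<le> (norm (grad a - grad b))\<^sup>2 / (2 * \<mu>)"
proof -
  let ?p = "norm (grad a - grad b)" and ?d = "norm (a - b)"
  have "breg a b + breg b a = (grad a - grad b) \<bullet> (a - b)"
    by (simp add: bregman_def algebra_simps inner_diff_left inner_diff_right)
  also have "\<dots> \<le> ?p * ?d" by (rule norm_cauchy_schwarz)
  finally have "breg a b \<le> ?p * ?d - \<mu> / 2 * ?d\<^sup>2"
    using breg_lower_bound[OF interior_dom[OF b] a] by (simp add: norm_minus_commute)
  also have "\<dots> \<le> ?p\<^sup>2 / (2 * \<mu>)"
  proof -
    have "0 \<le> (?p - \<mu> * ?d)\<^sup>2 / (2 * \<mu>)" using mu_pos by simp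
    also have "\<dots> = ?p\<^sup>2 / (2 * \<mu>) - (?p * ?d - \<mu> / 2 * ?d\<^sup>2)"
      using mu_pos by (simp add: field_simps power2_eq_square)
    finally show ?thesis by simp
  qed
  finally show ?thesis .
qed

section \<open>Minimisers of linearly tilted Legendre functions\<close>

text \<open>If the minimiser \<open>v\<close> were a boundary point, one could approach it from the interior point \<open>z\<close>
  along a segment, on which gradients must blow up. Minimality of \<open>v\<close> bounds their component along
  \<open>z - v\<close> from below. The gradient inequality, tested at points of a ball around \<open>z\<close> on which \<open>\<omega>\<close> is
  bounded above, then bounds their norms.\<close>

lemma minimiser_in_interior:
  assumes "convex S" "S \<subseteq> dom" "z \<in> S" "z \<in> interior dom" "v \<in> S"
    and min: "\<And>u. u \<in> S \<Longrightarrow> val v - p \<bullet> v \<le> val u - p \<bullet> u"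
  shows "v \<in> interior dom"
proof (rule ccontr)
  assume nint: "v \<notin> interior dom"
  have vD: "v \<in> dom" using assms by auto
  then have front: "v \<in> frontier dom"
    using nint closure_subset by (auto simp: frontier_def)
  define s where "s = (\<lambda>k. v - inverse (real (Suc k)) *\<^sub>R (v - z))"
  have s_int: "s k \<in> interior dom" for k
    unfolding s_def using mem_interior_convex_shrink[OF convex_dom assms(4) vD, of "inverse (real (Suc k))"]
    by (simp add: field_simps)
  have "s \<longlonglongrightarrow> v - 0 *\<^sub>R (v - z)"
    unfolding s_def by (intro tendsto_intros LIMSEQ_inverse_real_of_nat)
  then have "s \<longlonglongrightarrow> v" by simp
  then have blowup: "filterlim (\<lambda>k. norm (grad (s k))) at_top sequentially"
    using legendre s_int front unfolding legendre_fun_def essentially_smooth_def by blast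
  have "isCont val z"
    using gderiv_grad[OF assms(4)] has_derivative_continuous unfolding gderiv_def by blast
  then have "\<forall>\<^sub>F u in nhds z. val u < val z + 1"
    unfolding isCont_def tendsto_at_iff_tendsto_nhds[of val z] by (rule order_tendstoD(2)) simp
  then have "\<forall>\<^sub>F u in nhds z. val u < val z + 1 \<and> u \<in> dom"
    using eventually_nhds_in_open[OF open_interior assms(4)]
    by eventually_elim (auto dest: interior_dom)
  then obtain e where e: "e > 0" "\<And>u. dist u z < e \<Longrightarrow> val u < val z + 1 \<and> u \<in> dom"
    by (auto simp: eventually_nhds_metric)
  define C where "C = norm p * norm (z - v)"
  have bound: "e / 2 * norm (grad (s k)) \<le> val z + 1 - val v + 2 * C" for k
  proof -
    define t where "t = inverse (real (Suc k))"
    define g where "g = grad (s k)"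
    have t: "0 < t" "t \<le> 1" by (auto simp: t_def field_simps)
    have s: "s k = v + t *\<^sub>R (z - v)" by (simp add: s_def t_def algebra_simps)
    also have "\<dots> = (1 - t) *\<^sub>R v + t *\<^sub>R z" by (simp add: algebra_simps)
    also have "\<dots> \<in> S"
      using \<open>convex S\<close> assms(3,5) t unfolding convex_alt by auto
    finally have sS: "s k \<in> S" .
    have pz: "\<bar>p \<bullet> (z - v)\<bar> \<le> C"
      unfolding C_def by (rule Cauchy_Schwarz_ineq2)
    have val_s: "val (s k) \<ge> val v + t * (p \<bullet> (z - v))"
      using min[OF sS] by (simp add: s inner_add_right)
    have "val v \<ge> val (s k) + g \<bullet> (v - s k)"
      using breg_nonneg[OF vD s_int[of k]] by (simp add: bregman_def g_def)
    then have "t * (g \<bullet> (z - v)) \<ge> t * (p \<bullet> (z - v))"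
      using val_s by (simp add: s)
    then have slope: "g \<bullet> (z - v) \<ge> p \<bullet> (z - v)"
      using t by simp
    (* a point of the ball displaced from z along the gradient, so that the gradient inequality
       at s k sees the full norm of g *)
    define d where "d = (e / 2) *\<^sub>R sgn g"
    have "norm d < e" using \<open>e > 0\<close> by (simp add: d_def norm_sgn)
    then have "val (z + d) < val z + 1" "z + d \<in> dom"
      using e(2)[of "z + d"] by (auto simp: dist_norm)
    moreover have "val (z + d) \<ge> val (s k) + g \<bullet> (z + d - s k)"
      using breg_nonneg[OF \<open>z + d \<in> dom\<close> s_int[of k]] by (simp add: bregman_def g_def)
    moreover have "g \<bullet> (z + d - s k) = (1 - t) * (g \<bullet> (z - v)) + g \<bullet> d"
      by (simp add: s algebra_simps inner_diff_right inner_add_right)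
    moreover have "(1 - t) * (g \<bullet> (z - v)) \<ge> (1 - t) * (p \<bullet> (z - v))"
      using slope t by (simp add: mult_left_mono)
    moreover have "g \<bullet> d = e / 2 * norm g"
      by (simp add: d_def inner_sgn_self)
    moreover have "p \<bullet> (z - v) \<ge> - C" "C \<ge> 0" using pz by (auto simp: C_def)
    ultimately show ?thesis
      using val_s unfolding g_def[symmetric] by (simp add: algebra_simps)
  qed
  obtain k where "norm (grad (s k)) > (val z + 1 - val v + 2 * C) / (e / 2)"
    using blowup[unfolded filterlim_at_top_dense] by (meson eventually_sequentially order_refl)
  then show False using bound[of k] \<open>e > 0\<close> by (simp add: field_simps)
qed

lemma minimiser_variational_ineq:
  assumes "convex S" "v \<in> S" "v \<in> interior dom" "u \<in> S"
    and min: "\<And>u. u \<in> S \<Longrightarrow> val v - p \<bullet> v \<le> val u - p \<bullet> u"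
  shows "p \<bullet> (u - v) \<le> grad v \<bullet> (u - v)"
proof -
  have "p \<bullet> (u - v) \<le> (val (v + t *\<^sub>R (u - v)) - val v) / t" if "0 < t" "t < 1" for t
  proof -
    have "(1 - t) *\<^sub>R v + t *\<^sub>R u \<in> S"
      using assms that unfolding convex_alt by auto
    moreover have "(1 - t) *\<^sub>R v + t *\<^sub>R u = v + t *\<^sub>R (u - v)"
      by (simp add: algebra_simps)
    ultimately have "val v - p \<bullet> v \<le> val (v + t *\<^sub>R (u - v)) - p \<bullet> (v + t *\<^sub>R (u - v))"
      using min by metis
    then show ?thesis using that by (simp add: inner_add_right pos_le_divide_eq mult.commute)
  qed
  then have "\<forall>\<^sub>F t in at_right 0. p \<bullet> (u - v) \<le> (val (v + t *\<^sub>R (u - v)) - val v) / t"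
    by (auto simp: eventually_at_right[of 0 "1::real"] intro!: exI[of _ 1])
  then show ?thesis
    using tendsto_lowerbound[OF directional_limit[OF assms(3)]] by simp
qed

text \<open>Strong convexity forces quadratic growth around an interior point \<open>z\<close>, so the half-space of all
  \<open>(u, r)\<close> with \<open>r - p \<bullet> u \<le> val z - p \<bullet> z\<close> meets the epigraph of \<open>\<omega>\<close> in a bounded set. This set is
  closed because \<open>\<omega>\<close> is, hence \<open>r - p \<bullet> u\<close> attains its minimum over it.\<close>

lemma tilted_minimiser_exists: "\<exists>v\<in>dom. \<forall>u\<in>dom. val v - p \<bullet> v \<le> val u - p \<bullet> u"
proof -
  obtain z where z: "z \<in> interior dom"
    using legendre unfolding legendre_fun_def essentially_smooth_def by blast
  note zD = interior_dom[OF z]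
  define g where "g = grad z - p"
  define E where "E = {(u, r). \<omega> u \<le> ereal r} \<inter> {(u, r). r - p \<bullet> u \<le> val z - p \<bullet> z}"
  have val_le: "u \<in> dom \<and> val u \<le> r" if "\<omega> u \<le> ereal r" for u r
  proof -
    have "u \<in> dom" using that by (cases "\<omega> u") (auto simp: edom_def)
    then show ?thesis using that ereal_val by (metis ereal_less_eq(3))
  qed
  have "closed {(u, r). r - p \<bullet> u \<le> val z - p \<bullet> z}"
    unfolding case_prod_unfold by (intro closed_Collect_le continuous_intros)
  then have "closed E"
    unfolding E_def using legendre by (auto simp: legendre_fun_def closed_fun_def)
  define R where "R = 2 * norm g / \<mu>"
  have in_ball: "norm (u - z) \<le> R" "\<bar>r\<bar> \<le> \<bar>val z - p \<bullet> z\<bar> + norm p * (R + norm z) + norm g * R"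
    if "(u, r) \<in> E" for u r
  proof -
    have ur: "u \<in> dom" "val u \<le> r" "r - p \<bullet> u \<le> val z - p \<bullet> z"
      using that val_le by (auto simp: E_def)
    have strong: "\<mu> / 2 * (norm (u - z))\<^sup>2 \<le> val u - val z - grad z \<bullet> (u - z)"
      using breg_lower_bound[OF ur(1) z] by (simp add: bregman_def)
    then have "\<mu> / 2 * (norm (u - z))\<^sup>2 \<le> - (g \<bullet> (u - z))"
      using ur by (simp add: g_def inner_diff_left inner_diff_right)
    also have "\<dots> \<le> norm g * norm (u - z)"
      using norm_cauchy_schwarz[of "- g" "u - z"] by simp
    finally have quad: "\<mu> / 2 * norm (u - z) * norm (u - z) \<le> norm g * norm (u - z)"
      by (simp add: power2_eq_square)
    show uR: "norm (u - z) \<le> R"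
    proof (cases "u = z")
      case True
      then show ?thesis using mu_pos by (simp add: R_def)
    next
      case False
      then have "\<mu> / 2 * norm (u - z) \<le> norm g"
        using quad mult_le_cancel_right_pos[of "norm (u - z)"] by simp
      then show ?thesis using mu_pos by (simp add: R_def field_simps)
    qed
    have "norm u \<le> R + norm z" using uR norm_triangle_sub[of u z] by simp
    then have "norm p * norm u \<le> norm p * (R + norm z)" by (intro mult_left_mono) auto
    then have pu: "\<bar>p \<bullet> u\<bar> \<le> norm p * (R + norm z)"
      using Cauchy_Schwarz_ineq2[of p u] by simp
    have "norm g * norm (u - z) \<le> norm g * R" using uR by (intro mult_left_mono) auto
    then have "\<bar>g \<bullet> (u - z)\<bar> \<le> norm g * R"
      using Cauchy_Schwarz_ineq2[of g "u - z"] by simp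
    moreover have "r \<ge> val z + grad z \<bullet> (u - z)"
      using strong ur mu_pos by (smt (verit) zero_le_mult_iff zero_le_power2 half_gt_zero)
    ultimately have "r - p \<bullet> u \<ge> val z - p \<bullet> z - norm g * R" 
      by (simp add: g_def inner_diff_left inner_diff_right)
    then show "\<bar>r\<bar> \<le> \<bar>val z - p \<bullet> z\<bar> + norm p * (R + norm z) + norm g * R"
      using ur(3) pu \<open>\<bar>g \<bullet> (u - z)\<bar> \<le> norm g * R\<close> by linarith
  qed
  have "E \<subseteq> cball z R \<times> cball 0 (\<bar>val z - p \<bullet> z\<bar> + norm p * (R + norm z) + norm g * R)"
    using in_ball by (auto simp: dist_norm norm_minus_commute)
  then have "bounded E"
    using bounded_Times[OF bounded_cball bounded_cball] bounded_subset by blast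
  then have "compact E" using \<open>closed E\<close> by (simp add: compact_eq_bounded_closed)
  moreover have "(z, val z) \<in> E" using ereal_val[OF zD] by (simp add: E_def)
  moreover have "continuous_on E (\<lambda>q. snd q - p \<bullet> fst q)" by (intro continuous_intros)
  ultimately obtain q where q: "q \<in> E" "\<And>q'. q' \<in> E \<Longrightarrow> snd q - p \<bullet> fst q \<le> snd q' - p \<bullet> fst q'"
    using continuous_attains_inf[of E "\<lambda>q. snd q - p \<bullet> fst q"] by blast
  define v where "v = fst q"
  have v: "v \<in> dom" "val v \<le> snd q" "snd q - p \<bullet> v \<le> val z - p \<bullet> z"
    using q(1) val_le[of v "snd q"] by (auto simp: E_def v_def case_prod_unfold)
  have "val v - p \<bullet> v \<le> val u - p \<bullet> u" if "u \<in> dom" for u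
  proof (cases "(u, val u) \<in> E")
    case True
    then show ?thesis using q(2)[OF True] v by (simp add: v_def)
  next
    case False
    then have "val u - p \<bullet> u > val z - p \<bullet> z" using ereal_val[OF that] by (simp add: E_def)
    then show ?thesis using v by linarith
  qed
  then show ?thesis using v(1) by blast
qed

section \<open>The conjugate gradient inverts the gradient\<close>

text \<open>The minimiser of \<open>\<omega> - \<langle>p, \<cdot>\<rangle>\<close> over the whole domain is interior, so the variational inequality
  there may be tested in every direction, in particular in that of \<open>p - grad v\<close>.\<close>

lemma gradient_surj: "\<exists>v\<in>interior dom. grad v = p"
proof -
  obtain v where v: "v \<in> dom" "\<And>u. u \<in> dom \<Longrightarrow> val v - p \<bullet> v \<le> val u - p \<bullet> u"
    using tilted_minimiser_exists by blast
  obtain z where z: "z \<in> interior dom"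
    using legendre unfolding legendre_fun_def essentially_smooth_def by blast
  have vi: "v \<in> interior dom"
    using minimiser_in_interior[OF convex_dom _ interior_dom[OF z] z v] by blast
  then obtain e where e: "e > 0" "cball v e \<subseteq> dom"
    by (meson mem_interior_cball)
  define d where "d = e *\<^sub>R sgn (p - grad v)"
  have "norm d \<le> e" using e by (simp add: d_def norm_sgn)
  then have "v + d \<in> dom" using e by (auto simp: dist_norm)
  then have "(p - grad v) \<bullet> d \<le> 0"
    using minimiser_variational_ineq[OF convex_dom v(1) vi _ v(2), of "v + d"] by (simp add: inner_diff_left)
  moreover have "(p - grad v) \<bullet> d = e * norm (p - grad v)"
    by (simp add: d_def inner_sgn_self)
  ultimately have "grad v = p" using e by (simp add: mult_le_0_iff)
  then show ?thesis using vi by blast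
qed

lemma conjugate_at_gradient:
  assumes "v \<in> interior dom"
  shows "conjugate_fun \<omega> (grad v) = ereal (v \<bullet> grad v - val v)"
  unfolding conjugate_fun_def
proof (rule antisym)
  show "(SUP u. ereal (u \<bullet> grad v) - \<omega> u) \<le> ereal (v \<bullet> grad v - val v)"
  proof (rule SUP_least)
    fix u
    show "ereal (u \<bullet> grad v) - \<omega> u \<le> ereal (v \<bullet> grad v - val v)"
    proof (cases "u \<in> dom")
      case True
      then show ?thesis
        using breg_nonneg[OF True assms]
        by (subst ereal_val[OF True]) (simp add: bregman_def inner_diff_right inner_commute)
    qed (simp add: outside_dom)
  qed
  have "ereal (v \<bullet> grad v - val v) = ereal (v \<bullet> grad v) - \<omega> v"
    using ereal_val[OF interior_dom[OF assms]] by (metis ereal_minus(1))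
  also have "\<dots> \<le> (SUP u. ereal (u \<bullet> grad v) - \<omega> u)" by (rule SUP_upper) simp
  finally show "ereal (v \<bullet> grad v - val v) \<le> (SUP u. ereal (u \<bullet> grad v) - \<omega> u)" .
qed

text \<open>At dual points \<open>q = grad a\<close> the remainder of the first-order expansion of the conjugate about
  \<open>grad v\<close> with slope \<open>v\<close> is exactly \<open>breg v a\<close>, which is quadratically small in \<open>q - grad v\<close>.\<close>

lemma conjugate_gradient_inverts:
  assumes v: "v \<in> interior dom"
  shows "egrad (conjugate_fun \<omega>) (grad v) = v"
proof (rule egrad_eqI)
  let ?c = "\<lambda>p. real_of_ereal (conjugate_fun \<omega> p)"
  have bound: "\<bar>?c q - ?c (grad v) - (q - grad v) \<bullet> v\<bar> \<le> (norm (q - grad v))\<^sup>2 / (2 * \<mu>)" for q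
  proof -
    obtain a where a: "a \<in> interior dom" "grad a = q" using gradient_surj by blast
    have "?c q - ?c (grad v) - (q - grad v) \<bullet> v = breg v a"
      using conjugate_at_gradient[OF a(1)] conjugate_at_gradient[OF v] a(2)
      by (simp add: bregman_def algebra_simps inner_diff_left inner_diff_right inner_commute)
    then show ?thesis
      using breg_nonneg[OF interior_dom[OF v] a(1)] breg_upper_bound[OF v a(1)] a(2)
      by (simp add: norm_minus_commute)
  qed
  have "((\<lambda>q. \<bar>?c q - ?c (grad v) - (q - grad v) \<bullet> v\<bar> / norm (q - grad v)) \<longlongrightarrow> 0) (at (grad v))"
  proof (rule tendsto_sandwich[where f = "\<lambda>_. 0" and h = "\<lambda>q. norm (q - grad v) / (2 * \<mu>)"])
    show "\<forall>\<^sub>F q in at (grad v). \<bar>?c q - ?c (grad v) - (q - grad v) \<bullet> v\<bar> / norm (q - grad v)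
            \<le> norm (q - grad v) / (2 * \<mu>)"
    proof (rule always_eventually, rule allI)
      fix q
      show "\<bar>?c q - ?c (grad v) - (q - grad v) \<bullet> v\<bar> / norm (q - grad v) \<le> norm (q - grad v) / (2 * \<mu>)"
        using divide_right_mono[OF bound[of q], of "norm (q - grad v)"] mu_pos
        by (cases "q = grad v") (auto simp: power2_eq_square)
    qed
    have "((\<lambda>q. norm (q - grad v) / (2 * \<mu>)) \<longlongrightarrow> norm (grad v - grad v) / (2 * \<mu>)) (at (grad v))"
      using mu_pos by (intro tendsto_intros) auto
    then show "((\<lambda>q. norm (q - grad v) / (2 * \<mu>)) \<longlongrightarrow> 0) (at (grad v))" by simp
    show "((\<lambda>q. 0) \<longlongrightarrow> (0::real)) (at (grad v))" by simp
    show "\<forall>\<^sub>F q in at (grad v). 0 \<le> \<bar>?c q - ?c (grad v) - (q - grad v) \<bullet> v\<bar> / norm (q - grad v)"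
      by simp
  qed
  then show "GDERIV ?c (grad v) :> v"
    unfolding gderiv_def has_derivative_iff_norm by (simp add: bounded_linear_inner_left)
qed

lemma
  shows mirror_point_interior: "egrad (conjugate_fun \<omega>) p \<in> interior dom"
    and grad_mirror_point: "grad (egrad (conjugate_fun \<omega>) p) = p"
  using gradient_surj[of p] conjugate_gradient_inverts by auto

section \<open>One step of the method\<close>

text \<open>Up to a constant, the objective of a proximal step is \<open>\<omega>\<close> tilted by \<open>grad w - l c\<close>, so the results
  on tilted minimisers apply, and the three-point identity rewrites the variational inequality.
  With \<open>l = 0\<close> this is the Bregman projection.\<close>

lemma prox_step:
  assumes w: "w \<in> interior dom" and S: "convex S" "S \<subseteq> dom" and z: "z \<in> S" "z \<in> interior dom"
    and arg: "argmin_over (\<lambda>u. l * (c \<bullet> u) + breg u w) S v"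
  shows "v \<in> S" "v \<in> interior dom"
    and "u \<in> S \<Longrightarrow> l * (c \<bullet> (v - u)) \<le> breg u w - breg u v - breg v w"
proof -
  show vS: "v \<in> S" using arg by (simp add: argmin_over_def is_arg_min_def)
  have min: "val v - (grad w - l *\<^sub>R c) \<bullet> v \<le> val u - (grad w - l *\<^sub>R c) \<bullet> u" if "u \<in> S" for u
  proof -
    have "l * (c \<bullet> v) + breg v w \<le> l * (c \<bullet> u) + breg u w"
      using arg that by (auto simp: argmin_over_def is_arg_min_def not_less)
    then show ?thesis by (simp add: bregman_def inner_diff_left inner_diff_right)
  qed
  show vi: "v \<in> interior dom"
    using minimiser_in_interior[OF S z vS min] .
  assume "u \<in> S"
  then have "(grad w - l *\<^sub>R c) \<bullet> (u - v) \<le> grad v \<bullet> (u - v)"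
    using minimiser_variational_ineq[OF S(1) vS vi _ min] by blast
  then show "l * (c \<bullet> (v - u)) \<le> breg u w - breg u v - breg v w"
    by (simp add: bregman_def inner_diff_left inner_diff_right algebra_simps)
qed

text \<open>The points \<open>y\<close> and \<open>x\<close> are prox steps from the same \<open>w\<close>. Testing the step for \<open>y\<close> at \<open>x\<close> and the
  step for \<open>x\<close> at \<open>u\<close> cancels \<open>breg x w\<close>. The term \<open>l * ((G y - G w') \<bullet> (y - x))\<close> that is left is at most
  \<open>\<mu> \<parallel>y - w'\<parallel> \<parallel>y - x\<parallel>\<close>, which the arithmetic-geometric mean inequality splits between
  \<open>breg y w\<close> and \<open>breg x y\<close>.\<close>

lemma extragradient_step:
  assumes w: "w \<in> interior dom"
    and X: "convex X" "X \<subseteq> \<Omega>" and \<Omega>: "convex \<Omega>" "\<Omega> \<subseteq> dom"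
    and z: "z \<in> X" "z \<in> interior dom"
    and lip: "L-lipschitz_on dom G" and l: "0 \<le> l" "l * L \<le> \<mu>"
    and w': "argmin_over (\<lambda>u. breg u w) \<Omega> w'"
    and y: "argmin_over (\<lambda>u. l * (G w' \<bullet> u) + breg u w) X y"
    and x: "argmin_over (\<lambda>u. l * (G y \<bullet> u) + breg u w) X x"
    and u: "u \<in> X"
  shows "l * (G y \<bullet> (y - u)) \<le> breg u w - breg u x"
proof -
  have XD: "X \<subseteq> dom" using X \<Omega> by blast
  note ys = prox_step[OF w X(1) XD z y] and xs = prox_step[OF w X(1) XD z x]
  have z\<Omega>: "z \<in> \<Omega>" using z X by blast
  note ws = prox_step[OF w \<Omega> z\<Omega> z(2), where l = 0 and v = w' and c = 0, simplified, OF w']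
  have yD: "y \<in> dom" using ys XD by blast
  have "breg y w' + breg w' w \<le> breg y w" using ws(3)[of y] ys(1) X by auto
  moreover have "0 \<le> breg w' w" using breg_nonneg[OF interior_dom[OF ws(2)] w] .
  (* Pythagoras for the projection: moving from w to w' only decreases the distance from y *)
  ultimately have yw: "\<mu> / 2 * (norm (y - w'))\<^sup>2 \<le> breg y w"
    using breg_lower_bound[OF yD ws(2)] by linarith
  have xy: "\<mu> / 2 * (norm (y - x))\<^sup>2 \<le> breg x y"
    using breg_lower_bound[OF interior_dom[OF xs(2)] ys(2)] by (simp add: norm_minus_commute)
  have "norm (G y - G w') \<le> L * norm (y - w')"
    using lipschitz_onD[OF lip yD interior_dom[OF ws(2)]] by (simp add: dist_norm)
  then have "(G y - G w') \<bullet> (y - x) \<le> L * norm (y - w') * norm (y - x)"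
    by (meson norm_cauchy_schwarz mult_right_mono norm_ge_zero order_trans)
  then have "l * ((G y - G w') \<bullet> (y - x)) \<le> l * (L * norm (y - w') * norm (y - x))"
    using l by (intro mult_left_mono)
  also have "\<dots> \<le> \<mu> * (norm (y - w') * norm (y - x))"
    using mult_right_mono[OF l(2), of "norm (y - w') * norm (y - x)"] by (simp add: mult.assoc)
  also have "\<dots> \<le> \<mu> * (((norm (y - w'))\<^sup>2 + (norm (y - x))\<^sup>2) / 2)"
    using sum_squares_bound[of "norm (y - w')" "norm (y - x)"] mu_pos
    by (intro mult_left_mono) auto
  finally have "l * ((G y - G w') \<bullet> (y - x)) \<le> breg y w + breg x y"
    using yw xy by (simp add: field_simps)
  moreover have "l * (G w' \<bullet> (y - x)) \<le> breg x w - breg x y - breg y w"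
    using ys(3)[OF xs(1)] .
  moreover have "l * (G y \<bullet> (x - u)) \<le> breg u w - breg u x - breg x w"
    using xs(3)[OF u] .
  moreover have "l * (G y \<bullet> (y - u))
      = l * ((G y - G w') \<bullet> (y - x)) + l * (G w' \<bullet> (y - x)) + l * (G y \<bullet> (x - u))"
    by (simp add: inner_diff_left inner_diff_right algebra_simps)
  ultimately show ?thesis by linarith
qed

text \<open>The dual displacement is \<open>a (grad x - grad x')\<close>. Its first-order effect on \<open>breg u\<close> is, by the
  three-point identity, \<open>a\<close> times the difference of the two distances plus \<open>a * breg x x'\<close>; its
  second-order effect is \<open>breg x w\<close>. Smoothness of the conjugate bounds these two errors, which gives
  the factors \<open>a\<close> and \<open>a\<^sup>2\<close>.\<close>

lemma inertial_step:
  assumes x: "x \<in> interior dom" and x': "x' \<in> interior dom" and w: "w \<in> interior dom"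
    and a: "0 \<le> a" and gw: "grad w = (1 + a) *\<^sub>R grad x - a *\<^sub>R grad x'"
  shows "breg u w \<le> breg u x + a * (breg u x - breg u x')
           + a * (1 + a) / (2 * \<mu>) * (norm (grad x - grad x'))\<^sup>2"
proof -
  let ?n = "(norm (grad x - grad x'))\<^sup>2 / (2 * \<mu>)"
  have d: "grad w - grad x = a *\<^sub>R (grad x - grad x')"
    using gw by (simp add: algebra_simps)
  have "breg x w \<le> (norm (grad w - grad x))\<^sup>2 / (2 * \<mu>)"
    using breg_upper_bound[OF x w] by (simp add: norm_minus_commute)
  also have "\<dots> = a\<^sup>2 * ?n"
    unfolding d using a by (simp add: power_mult_distrib)
  finally have xw: "breg x w \<le> a\<^sup>2 * ?n" .
  have "a * breg x x' \<le> a * ?n"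
    using breg_upper_bound[OF x x'] a by (rule mult_left_mono)
  moreover have "breg u w = breg u x + breg x w + (grad w - grad x) \<bullet> (x - u)"
    using three_points[of u x w] by (simp add: inner_diff_left)
  moreover have "(grad w - grad x) \<bullet> (x - u) = a * (breg u x + breg x x' - breg u x')"
    unfolding d three_points by simp
  moreover have "a * (1 + a) / (2 * \<mu>) * (norm (grad x - grad x'))\<^sup>2 = a * ?n + a\<^sup>2 * ?n"
    by (simp add: algebra_simps power2_eq_square add_divide_distrib)
  ultimately show ?thesis using xw by (simp add: algebra_simps)
qed

end

section \<open>Summation and ergodic averages\<close>

text \<open>Summation by parts with nonincreasing weights: each drop \<open>\<alpha> k - \<alpha> (Suc k)\<close> is paid for by the
  uniform bound \<open>M\<close> on \<open>d\<close>. Since \<open>\<alpha> 0 \<le> 1\<close>, the coefficient \<open>1 - \<alpha> 0\<close> of the initial distance is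
  nonnegative, and the contributions add up to a single \<open>M\<close>.\<close>

lemma inertial_telescoping:
  fixes d \<alpha> e c :: "nat \<Rightarrow> real"
  assumes step: "\<And>k. c k \<le> d k - d (Suc k) + \<alpha> k * (d k - prev d k) + e k"
    and d: "\<And>k. 0 \<le> d k" "\<And>k. d k \<le> M"
    and \<alpha>: "\<And>k. 0 \<le> \<alpha> k" "\<And>k. \<alpha> (Suc k) \<le> \<alpha> k" "\<alpha> 0 \<le> 1"
    and e: "\<And>k. 0 \<le> e k" "summable e"
  shows "(\<Sum>j<k. c j) \<le> M + (\<Sum>j. e j)"
proof -
  have inv: "(\<Sum>j<k. c j) \<le> (1 - \<alpha> 0) * d 0 - d k + \<alpha> k * prev d k + (\<alpha> 0 - \<alpha> k) * M + (\<Sum>j<k. e j)"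
    for k
  proof (induction k)
    case 0
    then show ?case by (simp add: prev_def algebra_simps)
  next
    case (Suc k)
    have "(\<alpha> k - \<alpha> (Suc k)) * d k \<le> (\<alpha> k - \<alpha> (Suc k)) * M"
      using d \<alpha> by (intro mult_left_mono) auto
    then show ?case using Suc step[of k] by (simp add: prev_def algebra_simps)
  qed
  have "prev d k \<le> M" using d by (cases k) (auto simp: prev_def)
  then have "\<alpha> k * prev d k \<le> \<alpha> k * M" using \<alpha> by (intro mult_left_mono)
  moreover have "(1 - \<alpha> 0) * d 0 \<le> (1 - \<alpha> 0) * M"
    using d \<alpha> by (intro mult_left_mono) auto
  moreover have "(\<Sum>j<k. e j) \<le> (\<Sum>j. e j)" using e by (intro sum_le_suminf) auto
  ultimately show ?thesis using inv[of k] d(1)[of k] by (simp add: algebra_simps)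
qed

lemma ergodic_avg_mem:
  assumes "convex S" "\<And>j. y j \<in> S" "\<And>j. l j > 0" "k \<ge> 1"
  shows "ergodic_avg l y k \<in> S"
proof -
  have pos: "(\<Sum>j<k. l j) > 0" using assms by (intro sum_pos) (auto simp: lessThan_empty_iff)
  have "ergodic_avg l y k = (\<Sum>j<k. (l j / (\<Sum>j<k. l j)) *\<^sub>R y j)"
    by (simp add: ergodic_avg_def scaleR_sum_right)
  moreover have "(\<Sum>j<k. (l j / (\<Sum>j<k. l j)) *\<^sub>R y j) \<in> S"
    using assms pos
    by (intro convex_sum) (auto simp: sum_divide_distrib[symmetric] intro!: divide_nonneg_nonneg sum_nonneg less_imp_le)
  ultimately show ?thesis by simp
qed

lemma ergodic_avg_inner:
  assumes "(\<Sum>j<k. l j) \<noteq> 0"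
  shows "(\<Sum>j<k. l j) * (g \<bullet> (ergodic_avg l y k - u)) = (\<Sum>j<k. l j * (g \<bullet> (y j - u)))"
proof -
  let ?L = "\<Sum>j<k. l j"
  have "?L * (g \<bullet> (ergodic_avg l y k - u)) = g \<bullet> (?L *\<^sub>R ergodic_avg l y k) - ?L * (g \<bullet> u)"
    by (simp add: inner_diff_right right_diff_distrib)
  also have "?L *\<^sub>R ergodic_avg l y k = (\<Sum>j<k. l j *\<^sub>R y j)"
    using assms by (simp add: ergodic_avg_def)
  finally show ?thesis
    by (simp add: inner_sum_right inner_diff_right right_diff_distrib sum_subtractf sum_distrib_right)
qed

lemma norm_le_sup_norm_on:
  "bdd_above ((\<lambda>u. norm (G u)) ` S) \<Longrightarrow> u \<in> S \<Longrightarrow> norm (G u) \<le> sup_norm_on G S"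
  unfolding sup_norm_on_def by (rule cSUP_upper)

text \<open>The set \<open>Q\<close> is arbitrary, so the distance need not be attained; points of \<open>Q\<close> whose distance to
  \<open>z\<close> is nearly minimal take the place of a projection.\<close>

lemma gap_ge_neg_infdist:
  assumes bdd: "bdd_above ((\<lambda>u. norm (H u)) ` Q)" and "Q \<noteq> {}"
  shows "ereal (- sup_norm_on H Q * infdist z Q) \<le> gap z H Q"
proof (rule ereal_le_epsilon2)
  fix e :: real assume e: "e > 0"
  let ?B = "sup_norm_on H Q"
  have norm_le: "norm (H q) \<le> ?B" if "q \<in> Q" for q
    using norm_le_sup_norm_on[OF bdd that] .
  then have B: "?B \<ge> 0" using \<open>Q \<noteq> {}\<close> by (meson all_not_in_conv norm_ge_zero order_trans)
  (* the summand 1 keeps the slack positive when ?B is 0 *)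
  have "infdist z Q < infdist z Q + e / (?B + 1)" using e B by simp
  then obtain q where q: "q \<in> Q" "dist z q < infdist z Q + e / (?B + 1)"
    using \<open>Q \<noteq> {}\<close> cInf_lessD[of "dist z ` Q"] by (force simp: infdist_notempty)
  have "?B * (e / (?B + 1)) \<le> e" using e B by (simp add: field_simps)
  moreover have "?B * dist z q \<le> ?B * (infdist z Q + e / (?B + 1))"
    using q B by (intro mult_left_mono) auto
  moreover have "norm (H q) * dist z q \<le> ?B * dist z q"
    using norm_le[OF q(1)] by (intro mult_right_mono) auto
  moreover have "- (H q \<bullet> (z - q)) \<le> norm (H q) * dist z q"
    using norm_cauchy_schwarz[of "- H q" "z - q"] by (simp add: dist_norm)
  ultimately have "- ?B * infdist z Q \<le> H q \<bullet> (z - q) + e" by (simp add: algebra_simps)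
  then have "ereal (- ?B * infdist z Q) \<le> ereal (H q \<bullet> (z - q)) + ereal e" by simp
  also have "\<dots> \<le> gap z H Q + ereal e"
    unfolding gap_def using q(1) by (intro add_right_mono SUP_upper)
  finally show "ereal (- ?B * infdist z Q) \<le> gap z H Q + ereal e" .
qed


section \<open>The iterates of the method\<close>

context strongly_convex_legendre
begin

text \<open>The starting point shows that \<open>X\<close> meets the interior of the domain, which is what
  \<open>prox_step\<close> needs in order to keep all later iterates in the interior.\<close>

lemma iterates_interior_and_mirror:
  assumes alg: "IneIREG_Bregman \<omega> \<Omega> X F H \<alpha> l \<eta> x w w' y"
    and X: "convex X" "X \<subseteq> dom"
  shows "w k \<in> interior dom" "x k \<in> X" "x k \<in> interior dom" "y k \<in> X"
    and "grad (w k) = (1 + \<alpha> k) *\<^sub>R grad (x k) - \<alpha> k *\<^sub>R grad (prev x k)"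
proof -
  have x0: "x 0 \<in> X" "x 0 \<in> interior dom" using alg by (auto simp: IneIREG_Bregman_def)
  have weq: "w k = egrad (conjugate_fun \<omega>) ((1 + \<alpha> k) *\<^sub>R grad (x k) - \<alpha> k *\<^sub>R grad (prev x k))"
    and y: "argmin_over (\<lambda>u. l k * ((F (w' k) + \<eta> k *\<^sub>R H (w' k)) \<bullet> u) + breg u (w k)) X (y k)"
    and x: "argmin_over (\<lambda>u. l k * ((F (y k) + \<eta> k *\<^sub>R H (y k)) \<bullet> u) + breg u (w k)) X (x (Suc k))" for k
    using alg unfolding IneIREG_Bregman_def by blast+
  show grad_w: "grad (w k) = (1 + \<alpha> k) *\<^sub>R grad (x k) - \<alpha> k *\<^sub>R grad (prev x k)"
    using weq[of k] grad_mirror_point by simp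
  show w: "w k \<in> interior dom" for k unfolding weq[of k] by (rule mirror_point_interior)
  show "y k \<in> X" using prox_step(1)[OF w X x0 y] .
  show "x k \<in> X" "x k \<in> interior dom"
    using x0 prox_step(1,2)[OF w X x0 x] by (cases k; simp)+
qed

lemma bregman_le_diam_sq:
  "bdd_above (bregman_vals \<omega> X) \<Longrightarrow> u \<in> X \<Longrightarrow> v \<in> X \<Longrightarrow> v \<in> interior dom
    \<Longrightarrow> breg u v \<le> bregman_diam_sq \<omega> X"
  unfolding bregman_diam_sq_def by (rule cSup_upper) (auto simp: bregman_vals_def)

lemma weighted_regret_bound:
  assumes alg: "IneIREG_Bregman \<omega> \<Omega> X F H \<alpha> l \<eta> x w w' y"
    and X: "convex X" "X \<subseteq> \<Omega>" and \<Omega>: "convex \<Omega>" "\<Omega> \<subseteq> dom"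
    and lip: "\<And>k. (L k)-lipschitz_on dom (\<lambda>u. F u + \<eta> k *\<^sub>R H u)" "\<And>k. l k * L k \<le> \<mu>"
    and \<alpha>: "\<And>k. \<alpha> (Suc k) \<le> \<alpha> k" "\<alpha> 0 \<le> 1"
    and bdd: "bdd_above (bregman_vals \<omega> X)" and summ: "summable (inertial_err \<mu> \<omega> \<alpha> x)"
    and u: "u \<in> X"
  shows "(\<Sum>j<k. l j * ((F (y j) + \<eta> j *\<^sub>R H (y j)) \<bullet> (y j - u)))
           \<le> bregman_diam_sq \<omega> X + (\<Sum>j. inertial_err \<mu> \<omega> \<alpha> x j)"
proof (rule inertial_telescoping[where d = "\<lambda>j. breg u (x j)" and \<alpha> = \<alpha>])
  have XD: "X \<subseteq> dom" using X \<Omega> by blast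
  note it = iterates_interior_and_mirror[OF alg X(1) XD]
  have pos: "0 \<le> \<alpha> k" "0 \<le> l k" for k
    using alg by (auto simp: IneIREG_Bregman_def intro: less_imp_le)
  show "0 \<le> breg u (x k)" for k using breg_nonneg it(3) u XD by blast
  show "breg u (x k) \<le> bregman_diam_sq \<omega> X" for k
    using bregman_le_diam_sq[OF bdd u] it by blast
  show "0 \<le> inertial_err \<mu> \<omega> \<alpha> x k" for k
    using pos[of k] mu_pos by (simp add: inertial_err_def)
  show "l k * ((F (y k) + \<eta> k *\<^sub>R H (y k)) \<bullet> (y k - u))
      \<le> breg u (x k) - breg u (x (Suc k))
        + \<alpha> k * (breg u (x k) - prev (\<lambda>j. breg u (x j)) k) + inertial_err \<mu> \<omega> \<alpha> x k" for k
  proof -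
    have "l k * ((F (y k) + \<eta> k *\<^sub>R H (y k)) \<bullet> (y k - u)) \<le> breg u (w k) - breg u (x (Suc k))"
      by (rule extragradient_step[OF it(1) X \<Omega> it(2,3) lip(1) pos(2) lip(2), where w' = "w' k"])
        (use alg u in \<open>unfold IneIREG_Bregman_def, blast+\<close>)
    moreover have "prev x k \<in> interior dom"
      using it(3) by (cases k) (simp_all add: prev_def)
    then have "breg u (w k) \<le> breg u (x k) + \<alpha> k * (breg u (x k) - breg u (prev x k)) + inertial_err \<mu> \<omega> \<alpha> x k"
      unfolding inertial_err_def using inertial_step[OF it(3) _ it(1) pos(1) it(5)] by blast
    moreover have "prev (\<lambda>j. breg u (x j)) k = breg u (prev x k)"
      by (cases k) (simp_all add: prev_def)
    ultimately show ?thesis by simp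
  qed
qed (use alg \<alpha> summ in \<open>auto simp: IneIREG_Bregman_def\<close>)

end

section \<open>Gap bounds for the ergodic average\<close>

text \<open>The bound is on the dual gap, where the operator is evaluated at \<open>u\<close>: only then is the left-hand
  side affine in the iterates, so that it passes to the average.\<close>

lemma monotone_ergodic_bound:
  assumes l: "\<And>j. 0 < l j" and k: "k \<ge> 1"
    and mono: "\<And>j. (G (y j) - G u) \<bullet> (y j - u) \<ge> 0"
    and sum: "(\<Sum>j<k. l j * (G (y j) \<bullet> (y j - u))) \<le> B"
    and lo: "\<And>j. m \<le> l j" "m > 0" and B: "B \<ge> 0"
  shows "G u \<bullet> (ergodic_avg l y k - u) \<le> 1 / real k * (B / m)"
proof -
  let ?L = "\<Sum>j<k. l j" and ?v = "G u \<bullet> (ergodic_avg l y k - u)"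
  have L: "real k * m \<le> ?L" using sum_bounded_below[of "{..<k}" m l] lo by simp
  have km: "0 < real k * m" using k lo by simp
  have "?L * ?v = (\<Sum>j<k. l j * (G u \<bullet> (y j - u)))"
    using ergodic_avg_inner[of l k] L km by simp
  also have "\<dots> \<le> (\<Sum>j<k. l j * (G (y j) \<bullet> (y j - u)))"
    using mono l by (intro sum_mono mult_left_mono) (auto simp: inner_diff_left less_imp_le)
  finally have "?L * ?v \<le> B" using sum by simp
  then have "?v \<le> B / ?L" using L km by (simp add: pos_le_divide_eq mult.commute)
  also have "\<dots> \<le> B / (real k * m)" using L km B by (intro divide_left_mono) auto
  finally show ?thesis by simp
qed

lemma weakly_sharp_infdist_le:
  assumes ws: "weakly_sharp \<sigma> M F X Q" and q: "q \<in> Q" and z: "z \<in> X"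
    and le: "F q \<bullet> (z - q) \<le> R"
  shows "infdist z Q \<le> R powr (1 / M) / \<sigma> powr (1 / M)"
proof -
  have s: "\<sigma> > 0" "M \<ge> 1" "\<sigma> * infdist z Q powr M \<le> F q \<bullet> (z - q)"
    using ws q z by (auto simp: weakly_sharp_def)
  then have pw: "infdist z Q powr M \<le> R / \<sigma>"
    using le by (simp add: pos_le_divide_eq mult.commute)
  then have R: "R \<ge> 0" using s by (smt (verit) divide_neg_pos powr_ge_zero)
  have "infdist z Q = (infdist z Q powr M) powr (1 / M)"
    using s by (simp add: powr_powr infdist_nonneg)
  also have "\<dots> \<le> (R / \<sigma>) powr (1 / M)"
    using pw s by (intro powr_mono2) auto
  finally show ?thesis using R s by (simp add: powr_divide)
qed

theorem corollary10:
  fixes \<omega> :: "real ^ 'n \<Rightarrow> ereal"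
    and F H :: "real ^ 'n \<Rightarrow> real ^ 'n"
    and domF domH X \<Omega> Q :: "(real ^ 'n) set"
    and \<mu> L_F L_H L_0 l_lo l_hi \<eta>c C_H B_H D_X Omega_X_sq s_hat :: real
    and \<alpha> l \<eta> :: "nat \<Rightarrow> real"
    and x w w' y ybar :: "nat \<Rightarrow> real ^ 'n"
  assumes "\<mu> > 0" and "strongly_convex_fun \<mu> \<omega>" and "legendre_fun \<omega>"
    and "monotone_operator_on domF F" and "L_F > 0" and "L_F-lipschitz_on domF F"
    and "monotone_operator_on domH H" and "L_H > 0" and "L_H-lipschitz_on domH H"
    and "X \<noteq> {}" and "closed X" and "convex X"
    and "\<Omega> \<noteq> {}" and "closed \<Omega>" and "convex \<Omega>"
    and "X \<subseteq> \<Omega>" and "\<Omega> \<subseteq> edom \<omega>" and "edom \<omega> \<subseteq> domF \<inter> domH"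
    and "Q = VI_solutions F X" and "Q \<noteq> {}"
    and "bdd_above ((\<lambda>u. norm (H u)) ` X)" and "C_H = sup_norm_on H X"
    and "bdd_above ((\<lambda>u. norm (H u)) ` Q)" and "B_H = sup_norm_on H Q"
    and "bounded X" and "D_X = diameter X"
    and "bdd_above (bregman_vals \<omega> X)" and "Omega_X_sq = bregman_diam_sq \<omega> X"
    and "IneIREG_Bregman \<omega> \<Omega> X F H \<alpha> l \<eta> x w w' y"
    and "\<eta>c > 0" and "\<forall>k. \<eta> k = \<eta>c"
    and "\<alpha> 0 \<in> {0..1}" and "\<forall>k. \<alpha> k * inverse (\<eta> k) \<ge> \<alpha> (Suc k) * inverse (\<eta> (Suc k))"
    and "\<forall>k. l k \<in> {l_lo..l_hi}" and "0 < l_lo" and "l_lo \<le> l_hi"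
    and "l_hi \<le> \<mu> / L_0" and "L_0 = L_F + \<eta>c * L_H"
    and "summable (inertial_err \<mu> \<omega> \<alpha> x)" and "s_hat = (\<Sum>k. inertial_err \<mu> \<omega> \<alpha> x k)"
    and "\<forall>k\<ge>1. ybar k = ergodic_avg l y k"
  shows "(\<forall>k\<ge>1.
            0 \<le> gap (ybar k) F X \<and>
            gap (ybar k) F X
              \<le> ereal (1 / real k * ((Omega_X_sq + s_hat) / l_lo) + \<eta>c * (l_hi * C_H * D_X / l_lo))) \<and>
         (\<forall>k\<ge>1.
            ereal (- B_H * infdist (ybar k) Q) \<le> gap (ybar k) H Q \<and>
            gap (ybar k) H Q \<le> ereal (1 / real k * ((Omega_X_sq + s_hat) / (l_lo * \<eta>c)))) \<and>
         (\<forall>\<sigma> M. weakly_sharp \<sigma> M F X Q \<longrightarrow>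
            (\<forall>k\<ge>1.
               ereal (- (B_H / \<sigma> powr (1 / M)) *
                 (1 / real k * ((Omega_X_sq + s_hat) / l_lo)
                    + \<eta>c * (l_hi * C_H * D_X / l_lo)) powr (1 / M))
               \<le> gap (ybar k) H Q))"
proof -
  interpret strongly_convex_legendre \<omega> \<mu>
    using assms(1-3) by unfold_locales
  let ?S = "Omega_X_sq + s_hat"
  let ?G = "\<lambda>u. F u + \<eta>c *\<^sub>R H u"
  let ?R = "\<lambda>k. 1 / real k * (?S / l_lo) + \<eta>c * (l_hi * C_H * D_X / l_lo)"
  have \<Omega>D: "\<Omega> \<subseteq> edom \<omega>" and X\<Omega>: "X \<subseteq> \<Omega>" and XD: "X \<subseteq> edom \<omega>"
    and D: "edom \<omega> \<subseteq> domF" "edom \<omega> \<subseteq> domH" and QX: "Q \<subseteq> X"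
    using assms(16-19) by (auto simp: VI_solutions_def)
  note alg = assms(29) and \<eta> = assms(31)[rule_format]
  note it = iterates_interior_and_mirror[OF alg assms(12) XD]
  have l: "l_lo \<le> l j" "l j \<le> l_hi" "0 < l j" for j
    using assms(34)[rule_format, of j] assms(35) by auto
  have L0: "L_0 > 0" using assms(5,8,30,38) by (simp add: add_pos_pos)
  have lip: "L_0-lipschitz_on (edom \<omega>) ?G"
  proof -
    have "\<bar>\<eta>c\<bar> = \<eta>c" using assms(30) by simp
    then show ?thesis
      using lipschitz_on_add[OF lipschitz_on_subset[OF assms(6) D(1)]
          lipschitz_on_cmult[OF lipschitz_on_subset[OF assms(9) D(2)], of \<eta>c]] assms(38) by simp
  qed
  have lL: "l j * L_0 \<le> \<mu>" for j
    using l(2)[of j] assms(37) L0 by (simp add: pos_le_divide_eq) (meson mult_right_mono less_imp_le order_trans)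
  have \<alpha>: "\<alpha> (Suc k) \<le> \<alpha> k" for k
    using assms(33)[rule_format, of k] \<eta> assms(30) by simp
  have S: "?S \<ge> 0"
  proof -
    have "breg (x 0) (x 0) \<le> Omega_X_sq"
      using bregman_le_diam_sq[OF assms(27) it(2) it(2) it(3)] assms(28) by simp
    moreover have "0 \<le> s_hat"
      unfolding assms(40) using alg mu_pos
      by (intro suminf_nonneg assms(39)) (auto simp: inertial_err_def IneIREG_Bregman_def)
    ultimately show ?thesis by (simp add: bregman_def)
  qed
  have avg: "ybar k \<in> X" if "k \<ge> 1" for k
    using ergodic_avg_mem[OF assms(12) it(4) l(3) that] assms(41) that by simp
  have regret: "F u \<bullet> (ybar k - u) + \<eta>c * (H u \<bullet> (ybar k - u)) \<le> 1 / real k * (?S / l_lo)"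
    if u: "u \<in> X" and k: "k \<ge> 1" for u k
  proof -
    have mono: "(?G (y j) - ?G u) \<bullet> (y j - u) \<ge> 0" for j
    proof -
      have "0 \<le> (F (y j) - F u) \<bullet> (y j - u)" "0 \<le> (H (y j) - H u) \<bullet> (y j - u)"
        using assms(4,7) it(4)[of j] u XD D unfolding monotone_operator_on_def by blast+
      moreover have "(?G (y j) - ?G u) \<bullet> (y j - u)
          = (F (y j) - F u) \<bullet> (y j - u) + \<eta>c * ((H (y j) - H u) \<bullet> (y j - u))"
        by (simp add: inner_diff_left inner_add_left algebra_simps)
      ultimately show ?thesis using assms(30) by simp
    qed
    have "(\<Sum>j<k. l j * (?G (y j) \<bullet> (y j - u))) \<le> ?S"
      using weighted_regret_bound[OF alg assms(12) X\<Omega> assms(15) \<Omega>D _ lL \<alpha> _ assms(27,39) u] lip assms(28,32,40) \<eta>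
      by simp
    then have "?G u \<bullet> (ergodic_avg l y k - u) \<le> 1 / real k * (?S / l_lo)"
      using monotone_ergodic_bound[where G = ?G and l = l and y = y, OF l(3) k mono _ l(1) assms(35) S] by blast
    then show ?thesis using assms(41) k by (simp add: inner_add_left)
  qed
  have gapF: "F u \<bullet> (ybar k - u) \<le> ?R k" if u: "u \<in> X" and k: "k \<ge> 1" for u k
  proof -
    have H: "norm (H u) \<le> C_H" using norm_le_sup_norm_on[OF assms(21) u] assms(22) by simp
    have d: "norm (ybar k - u) \<le> D_X"
      using diameter_bounded_bound[OF assms(25) avg[OF k] u] assms(26) by (simp add: dist_norm)
    have CD: "0 \<le> C_H * D_X" "norm (H u) * norm (ybar k - u) \<le> C_H * D_X"
      using H d order_trans[OF norm_ge_zero H] order_trans[OF norm_ge_zero d] by (auto intro!: mult_mono)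
    (* the factor l_hi / l_lo is at least 1, so it can only weaken the bound *)
    have "C_H * D_X \<le> l_hi * (C_H * D_X) / l_lo"
      using mult_right_mono[OF assms(36) CD(1)] assms(35) by (simp add: pos_le_divide_eq mult.commute)
    moreover have "- (H u \<bullet> (ybar k - u)) \<le> norm (H u) * norm (ybar k - u)"
      using norm_cauchy_schwarz[of "- H u" "ybar k - u"] by simp
    ultimately have "- (H u \<bullet> (ybar k - u)) \<le> l_hi * C_H * D_X / l_lo"
      using CD(2) by (simp add: mult.assoc)
    then have "\<eta>c * - (H u \<bullet> (ybar k - u)) \<le> \<eta>c * (l_hi * C_H * D_X / l_lo)"
      using assms(30) by (intro mult_left_mono) auto
    then show ?thesis using regret[OF u k] by simp
  qed
  have gapH: "H u \<bullet> (ybar k - u) \<le> 1 / real k * (?S / (l_lo * \<eta>c))" if u: "u \<in> Q" and k: "k \<ge> 1" for u k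
  proof -
    have "0 \<le> F u \<bullet> (ybar k - u)"
      using u avg[OF k] assms(19) by (simp add: VI_solutions_def)
    then have "\<eta>c * (H u \<bullet> (ybar k - u)) \<le> 1 / real k * (?S / l_lo)"
      using regret[of u k] u QX k by fastforce
    then have "H u \<bullet> (ybar k - u) \<le> (1 / real k * (?S / l_lo)) / \<eta>c"
      by (simp only: pos_le_divide_eq[OF assms(30)] mult.commute)
    then show ?thesis by simp
  qed
  have lower: "ereal (- B_H * infdist (ybar k) Q) \<le> gap (ybar k) H Q" for k
    using gap_ge_neg_infdist[OF assms(23,20)] assms(24) by simp
  have B: "B_H \<ge> 0"
    using norm_le_sup_norm_on[OF assms(23)] assms(20,24) by (meson all_not_in_conv norm_ge_zero order_trans)
  have gapF_lower: "0 \<le> gap (ybar k) F X" if "k \<ge> 1" for k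
    unfolding gap_def by (rule SUP_upper2[OF avg[OF that]]) simp
  have gapF_upper: "gap (ybar k) F X \<le> ereal (?R k)" if "k \<ge> 1" for k
    unfolding gap_def using gapF that by (intro SUP_least) (simp only: ereal_less_eq)
  have gapH_upper: "gap (ybar k) H Q \<le> ereal (1 / real k * (?S / (l_lo * \<eta>c)))" if "k \<ge> 1" for k
    unfolding gap_def using gapH that by (intro SUP_least) (simp only: ereal_less_eq)
  have sharp: "ereal (- (B_H / \<sigma> powr (1 / M)) * ?R k powr (1 / M)) \<le> gap (ybar k) H Q"
    if ws: "weakly_sharp \<sigma> M F X Q" and k: "k \<ge> 1" for \<sigma> M k
  proof -
    obtain q where q: "q \<in> Q" using assms(20) by blast
    have "infdist (ybar k) Q \<le> ?R k powr (1 / M) / \<sigma> powr (1 / M)"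
      using weakly_sharp_infdist_le[OF ws q avg[OF k]] gapF[OF _ k] q QX by blast
    then have "B_H * infdist (ybar k) Q \<le> B_H * (?R k powr (1 / M) / \<sigma> powr (1 / M))"
      using B by (rule mult_left_mono)
    then have "ereal (- (B_H / \<sigma> powr (1 / M)) * ?R k powr (1 / M)) \<le> ereal (- B_H * infdist (ybar k) Q)"
      by simp
    then show ?thesis using lower order_trans by blast
  qed
  show ?thesis
    by (intro conjI allI impI) (erule gapF_lower gapF_upper gapH_upper sharp | rule lower | assumption)+
qed

end
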